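(* Let $u,v\in\mathbb{N}$, let $A$ be a $u\times v$ matrix with entries from $\mathbb{Z}[i]$ and assume that for all $\vec{z}\in(\mathbb{Z}[i]\setminus\{0\})^{v}$ one has $A\vec{z}\in(\mathbb{Z}[i]\setminus\{0\})^{u}$. If $C$ is PS$^{*}$ in $\mathbb{Z}[i]$, then $W=\{\vec{z}\in(\mathbb{Z}[i]\setminus\{0\})^{v}:A\vec{z}\in C^{u}\}$ is PS$^{*}$ in $(\mathbb{Z}[i])^{v}$.
   Context: $\mathbb{Z}[i]$ is the ring of Gaussian integers; $C^u$ is the set of vectors all of whose $u$ entries lie in $C$. In a commutative semigroup $(S,+)$, $B\subseteq S$ is piecewise syndetic if there is a finite nonempty $G\subseteq S$ such that for every finite nonempty $F\subseteq S$ there is $x\in S$ with $F+x\subseteq\bigcup_{t\in G}(-t+B)$, where $-t+B=\{s\in S:t+s\in B\}$; $B$ is PS$^*$ if $B$ meets every piecewise syndetic subset of $S$. *)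

theory Defs
  imports "HOL-Analysis.Finite_Cartesian_Product"
begin

typedef gauss_int = "{z :: complex. Re z \<in> \<int> \<and> Im z \<in> \<int>}"
  morphisms complex_of_gauss Abs_gauss_int
  by (rule exI[of _ 0]) simp

setup_lifting type_definition_gauss_int

instantiation gauss_int :: comm_ring_1
begin

lift_definition zero_gauss_int :: gauss_int is 0 by simp
lift_definition one_gauss_int :: gauss_int is 1 by simp
lift_definition plus_gauss_int :: "gauss_int \<Rightarrow> gauss_int \<Rightarrow> gauss_int" is "(+)" by simp
lift_definition minus_gauss_int :: "gauss_int \<Rightarrow> gauss_int \<Rightarrow> gauss_int" is "(-)" by simp
lift_definition uminus_gauss_int :: "gauss_int \<Rightarrow> gauss_int" is uminus by simp
lift_definition times_gauss_int :: "gauss_int \<Rightarrow> gauss_int \<Rightarrow> gauss_int" is "(*)" by simp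

instance
  by standard (transfer; simp add: algebra_simps)+

end

definition piecewise_syndetic :: "'a::ab_semigroup_add set \<Rightarrow> bool" where
  "piecewise_syndetic B \<longleftrightarrow>
     (\<exists>G. finite G \<and> G \<noteq> {} \<and>
       (\<forall>F. finite F \<and> F \<noteq> {} \<longrightarrow>
         (\<exists>x. (\<lambda>f. f + x) ` F \<subseteq> (\<Union>t\<in>G. {s. t + s \<in> B}))))"

definition PS_star :: "'a::ab_semigroup_add set \<Rightarrow> bool" where
  "PS_star B \<longleftrightarrow> (\<forall>P. piecewise_syndetic P \<longrightarrow> B \<inter> P \<noteq> {})"

definition vecs_over :: "'a set \<Rightarrow> ('a ^ 'n) set" where
  "vecs_over C = {x. \<forall>i. x $ i \<in> C}"

end

theory Submission imports Defs begin

text \<open>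
  Piecewise syndeticity is partition regular, so PS\<open>\<^sup>*\<close> sets are closed under finite
  intersections. An additive map whose image has finite index sends piecewise syndetic sets to
  piecewise syndetic sets, so it pulls PS\<open>\<^sup>*\<close> sets back to PS\<open>\<^sup>*\<close> sets. The set in question is the
  intersection of the preimages of the complement of 0 under the coordinate projections and of
  the preimages of \<open>C\<close> under the rows of \<open>A\<close>. The hypothesis forces every row to be nonzero,
  and a nonzero ideal of the Gaussian integers has finite index.
\<close>

section \<open>Partition regularity and intersections of PS* sets\<close>

lemma piecewise_syndeticI:
  assumes "finite G" "G \<noteq> {}"
    and "\<And>F. \<lbrakk>finite F; F \<noteq> {}\<rbrakk> \<Longrightarrow> \<exists>x. \<forall>f\<in>F. \<exists>t\<in>G. t + (f + x) \<in> B"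
  shows "piecewise_syndetic B"
proof -
  have "\<exists>x. (\<lambda>f. f + x) ` F \<subseteq> (\<Union>t\<in>G. {s. t + s \<in> B})" if F: "finite F" "F \<noteq> {}" for F
  proof -
    obtain x where "\<forall>f\<in>F. \<exists>t\<in>G. t + (f + x) \<in> B"
      using assms(3)[OF F] by blast
    then show ?thesis
      by (intro exI[of _ x]) auto
  qed
  then show ?thesis
    unfolding piecewise_syndetic_def using assms(1,2) by blast
qed

lemma piecewise_syndeticE:
  assumes "piecewise_syndetic B"
  obtains G where "finite G" "G \<noteq> {}"
    "\<And>F. \<lbrakk>finite F; F \<noteq> {}\<rbrakk> \<Longrightarrow> \<exists>x. \<forall>f\<in>F. \<exists>t\<in>G. t + (f + x) \<in> B"
proof -
  obtain G where G: "finite G" "G \<noteq> {}"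
    and *: "\<And>F. finite F \<and> F \<noteq> {} \<Longrightarrow> \<exists>x. (\<lambda>f. f + x) ` F \<subseteq> (\<Union>t\<in>G. {s. t + s \<in> B})"
    using assms unfolding piecewise_syndetic_def by blast
  have "\<exists>x. \<forall>f\<in>F. \<exists>t\<in>G. t + (f + x) \<in> B" if F: "finite F" "F \<noteq> {}" for F
  proof -
    obtain x where "(\<lambda>f. f + x) ` F \<subseteq> (\<Union>t\<in>G. {s. t + s \<in> B})"
      using *[of F] F by blast
    then show ?thesis
      by (intro exI[of _ x]) (auto simp: subset_iff)
  qed
  with G show ?thesis
    by (rule that)
qed

text \<open>\<open>T\<close> is thick: it contains a translate of every finite nonempty set. It is
  also covered by \<open>P'\<close> and \<open>Q'\<close>. If \<open>T - Q'\<close> is still thick,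
  so is \<open>P'\<close>, and \<open>G\<close> serves for \<open>P\<close>. Otherwise some finite
  set has no translate inside \<open>T - Q'\<close>, and this set supplies the extra shifts for
  \<open>Q\<close>.\<close>

lemma piecewise_syndetic_UnD:
  assumes "piecewise_syndetic (P \<union> Q)"
  shows "piecewise_syndetic P \<or> piecewise_syndetic Q"
proof -
  obtain G where G: "finite G" "G \<noteq> {}"
    and PQ: "\<And>F. \<lbrakk>finite F; F \<noteq> {}\<rbrakk> \<Longrightarrow> \<exists>x. \<forall>f\<in>F. \<exists>t\<in>G. t + (f + x) \<in> P \<union> Q"
    using piecewise_syndeticE[OF assms] by blast
  define T P' Q' where "T = {s. \<exists>t\<in>G. t + s \<in> P \<union> Q}"
    and "P' = {s. \<exists>t\<in>G. t + s \<in> P}" and "Q' = {s. \<exists>t\<in>G. t + s \<in> Q}"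
  have T: "T = P' \<union> Q'"
    unfolding T_def P'_def Q'_def by blast
  have thick: "\<exists>x. \<forall>f\<in>F. f + x \<in> T" if "finite F" "F \<noteq> {}" for F
    using PQ[OF that] unfolding T_def by simp
  show ?thesis
  proof (cases "\<forall>F. finite F \<and> F \<noteq> {} \<longrightarrow> (\<exists>x. \<forall>f\<in>F. f + x \<in> T - Q')")
    case True
    have "piecewise_syndetic P"
    proof (rule piecewise_syndeticI[OF G])
      fix F :: "'a set"
      assume "finite F" "F \<noteq> {}"
      then obtain x where "\<forall>f\<in>F. f + x \<in> T - Q'"
        using True by blast
      then have "\<forall>f\<in>F. f + x \<in> P'"
        using T by blast
      then show "\<exists>x. \<forall>f\<in>F. \<exists>t\<in>G. t + (f + x) \<in> P"
        unfolding P'_def by blast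
    qed
    then show ?thesis ..
  next
    case False
    \<comment> \<open>Every translate of \<open>E\<close> inside \<open>T\<close> meets \<open>Q'\<close>, so \<open>E\<close> witnesses that \<open>Q'\<close> is syndetic along \<open>T\<close>.\<close>
    then obtain E where E: "finite E" "E \<noteq> {}" and "\<nexists>x. \<forall>e\<in>E. e + x \<in> T - Q'"
      by blast
    then have meets: "\<exists>e\<in>E. e + x \<in> Q'" if "\<forall>e\<in>E. e + x \<in> T" for x
      using that by blast
    have "piecewise_syndetic Q"
    proof (rule piecewise_syndeticI)
      \<comment> \<open>A point is first moved into \<open>Q'\<close> by some \<open>e\<close> and
        from there into \<open>Q\<close> by some \<open>t\<close>, hence the sums.\<close>
      show "finite ((\<lambda>(t, e). t + e) ` (G \<times> E))" "(\<lambda>(t, e). t + e) ` (G \<times> E) \<noteq> {}"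
        using G E by auto
      fix F :: "'a set"
      assume F: "finite F" "F \<noteq> {}"
      \<comment> \<open>Thickness is applied to \<open>E + F\<close>, so that one \<open>x\<close>
        puts the whole translate \<open>E + (f + x)\<close> into \<open>T\<close> for each
        \<open>f\<close>, as \<open>meets\<close> requires.\<close>
      have "finite ((\<lambda>(e, f). e + f) ` (E \<times> F))" "(\<lambda>(e, f). e + f) ` (E \<times> F) \<noteq> {}"
        using E F by auto
      from thick[OF this] obtain x where "\<forall>f\<in>F. \<forall>e\<in>E. e + (f + x) \<in> T"
        by (auto simp: add.assoc)
      then have "\<forall>f\<in>F. \<exists>e\<in>E. e + (f + x) \<in> Q'"
        using meets by blast
      then show "\<exists>x. \<forall>f\<in>F. \<exists>t\<in>(\<lambda>(t, e). t + e) ` (G \<times> E). t + (f + x) \<in> Q"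
        unfolding Q'_def by (intro exI[of _ x]) (fastforce simp: add.assoc)
    qed
    then show ?thesis ..
  qed
qed

text \<open>Since \<open>C\<close> misses \<open>P - C\<close>, that part of \<open>P\<close> is not
  piecewise syndetic. By partition regularity \<open>P \<inter> C\<close> is, so \<open>B\<close>
  meets it.\<close>

lemma PS_star_Int:
  assumes "PS_star B" "PS_star C"
  shows "PS_star (B \<inter> C)"
  unfolding PS_star_def
proof (intro allI impI)
  fix P :: "'a set"
  assume P: "piecewise_syndetic P"
  have "\<not> piecewise_syndetic (P - C)"
    using assms(2) unfolding PS_star_def by blast
  moreover have "P = (P \<inter> C) \<union> (P - C)"
    by blast
  ultimately have "piecewise_syndetic (P \<inter> C)"
    using P piecewise_syndetic_UnD by metis
  then show "B \<inter> C \<inter> P \<noteq> {}"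
    using assms(1) unfolding PS_star_def by blast
qed

lemma PS_star_UNIV: "PS_star (UNIV :: 'a::ab_semigroup_add set)"
  unfolding PS_star_def
proof (intro allI impI)
  fix P :: "'a set"
  assume "piecewise_syndetic P"
  then obtain G where "\<And>F. \<lbrakk>finite F; F \<noteq> {}\<rbrakk> \<Longrightarrow> \<exists>x. \<forall>f\<in>F. \<exists>t\<in>G. t + (f + x) \<in> P"
    by (rule piecewise_syndeticE) blast
  \<comment> \<open>An arbitrary singleton test set already yields an element of
    \<open>P\<close>.\<close>
  from this[of "{undefined}"] show "UNIV \<inter> P \<noteq> {}"
    by auto
qed

lemma PS_star_INT:
  assumes "finite I" "\<And>i. i \<in> I \<Longrightarrow> PS_star (B i)"
  shows "PS_star (\<Inter>i\<in>I. B i)"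
  using assms by (induction I rule: finite_induct) (auto intro: PS_star_UNIV PS_star_Int)

section \<open>Additive maps with image of finite index; removing a point\<close>

lemma piecewise_syndetic_image:
  fixes h :: "'a::ab_group_add \<Rightarrow> 'b::ab_group_add"
  assumes add: "\<And>x y. h (x + y) = h x + h y"
    and R: "finite R" "\<And>y. \<exists>r\<in>R. \<exists>x. y = r + h x"
    and P: "piecewise_syndetic P"
  shows "piecewise_syndetic (h ` P)"
proof -
  obtain G where G: "finite G" "G \<noteq> {}"
    and GP: "\<And>F. \<lbrakk>finite F; F \<noteq> {}\<rbrakk> \<Longrightarrow> \<exists>x. \<forall>f\<in>F. \<exists>t\<in>G. t + (f + x) \<in> P"
    using piecewise_syndeticE[OF P] by blast
  \<comment> \<open>\<open>r y\<close> represents the coset of \<open>y\<close> modulo the image of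
    \<open>h\<close>, and \<open>g\<close> lifts the rest to the domain.\<close>
  obtain r g where rg: "\<And>y. r y \<in> R" "\<And>y. y = r y + h (g y)"
    using R(2) by metis
  show ?thesis
  proof (rule piecewise_syndeticI)
    \<comment> \<open>\<open>h t\<close> transports the shift used in the domain, while
      \<open>- s\<close> cancels the representative \<open>r f\<close>.\<close>
    show "finite ((\<lambda>(t, s). h t - s) ` (G \<times> R))"
      using G R by auto
    show "(\<lambda>(t, s). h t - s) ` (G \<times> R) \<noteq> {}"
      using G rg(1) by auto
    fix F :: "'b set"
    assume "finite F" "F \<noteq> {}"
    then obtain x where x: "\<forall>f\<in>g ` F. \<exists>t\<in>G. t + (f + x) \<in> P"
      using GP[of "g ` F"] by auto
    have "\<exists>s\<in>(\<lambda>(t, s). h t - s) ` (G \<times> R). s + (f + h x) \<in> h ` P" if f: "f \<in> F" for f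
    proof -
      obtain t where t: "t \<in> G" "t + (g f + x) \<in> P"
        using x f by blast
      have "(h t - r f) + (f + h x) = h t - r f + (r f + h (g f) + h x)"
        using rg(2)[of f] by simp
      also have "\<dots> = h (t + (g f + x))"
        by (simp add: add algebra_simps)
      finally have "(h t - r f) + (f + h x) \<in> h ` P"
        using t(2) by simp
      moreover have "h t - r f \<in> (\<lambda>(t, s). h t - s) ` (G \<times> R)"
        using t(1) rg(1)[of f] by auto
      ultimately show ?thesis
        by blast
    qed
    then show "\<exists>x. \<forall>f\<in>F. \<exists>s\<in>(\<lambda>(t, s). h t - s) ` (G \<times> R). s + (f + x) \<in> h ` P"
      by blast
  qed
qed

lemma PS_star_vimage:
  fixes h :: "'a::ab_group_add \<Rightarrow> 'b::ab_group_add"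
  assumes "\<And>x y. h (x + y) = h x + h y"
    and "finite R" "\<And>y. \<exists>r\<in>R. \<exists>x. y = r + h x"
    and "PS_star C"
  shows "PS_star (h -` C)"
  unfolding PS_star_def
proof (intro allI impI)
  fix P :: "'a set"
  assume "piecewise_syndetic P"
  then have "piecewise_syndetic (h ` P)"
    using assms(1-3) by (intro piecewise_syndetic_image[where R = R])
  then have "C \<inter> h ` P \<noteq> {}"
    using assms(4) unfolding PS_star_def by blast
  then show "h -` C \<inter> P \<noteq> {}"
    by blast
qed

text \<open>Pigeonhole: if \<open>P\<close> is contained in \<open>{a}\<close>, then for fixed
  \<open>x\<close> each \<open>f\<close> equals \<open>a - x - t\<close> with \<open>t\<close> in
  \<open>G\<close>. An infinite group has a finite \<open>F\<close> with more than
  \<open>card G\<close> elements, which admits no \<open>x\<close>.\<close>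

lemma PS_star_minus_singleton:
  assumes inf: "infinite (UNIV :: 'a::ab_group_add set)"
  shows "PS_star (UNIV - {a :: 'a})"
  unfolding PS_star_def
proof (intro allI impI notI)
  fix P :: "'a set"
  assume P: "piecewise_syndetic P" "(UNIV - {a}) \<inter> P = {}"
  obtain G where G: "finite G" "G \<noteq> {}"
    and GP: "\<And>F. \<lbrakk>finite F; F \<noteq> {}\<rbrakk> \<Longrightarrow> \<exists>x. \<forall>f\<in>F. \<exists>t\<in>G. t + (f + x) \<in> P"
    using piecewise_syndeticE[OF P(1)] by blast
  obtain F :: "'a set" where F: "finite F" "card F = Suc (card G)"
    using infinite_arbitrarily_large[OF inf] by blast
  then have "F \<noteq> {}"
    by auto
  with GP F(1) obtain x where "\<forall>f\<in>F. \<exists>t\<in>G. t + (f + x) \<in> P"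
    by blast
  then have "\<forall>f\<in>F. \<exists>t\<in>G. t + (f + x) = a"
    using P(2) by blast
  then have "\<forall>f\<in>F. \<exists>t\<in>G. f = a - x - t"
    by (metis add.commute add_diff_cancel_right' diff_diff_eq2 diff_add_eq)
  then have "F \<subseteq> (\<lambda>t. a - x - t) ` G"
    by blast
  then have "card F \<le> card G"
    using G(1) by (meson card_image_le card_mono finite_imageI le_trans)
  with F(2) show False
    by simp
qed

section \<open>Gaussian integers: finite boxes and division with remainder\<close>

lemma finite_gauss_int_bounded:
  "finite {z. \<bar>Re (complex_of_gauss z)\<bar> \<le> b \<and> \<bar>Im (complex_of_gauss z)\<bar> \<le> b}" (is "finite ?S")
proof -
  have "?S \<subseteq> (\<lambda>(m, n). Abs_gauss_int (Complex (of_int m) (of_int n))) `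
          ({-\<lceil>b\<rceil>..\<lceil>b\<rceil>} \<times> {-\<lceil>b\<rceil>..\<lceil>b\<rceil>})"
  proof
    fix z
    assume z: "z \<in> ?S"
    have "Re (complex_of_gauss z) \<in> \<int>" "Im (complex_of_gauss z) \<in> \<int>"
      using complex_of_gauss[of z] by auto
    then obtain m n where mn: "Re (complex_of_gauss z) = of_int m" "Im (complex_of_gauss z) = of_int n"
      by (auto elim!: Ints_cases)
    then have "z = Abs_gauss_int (Complex (of_int m) (of_int n))"
      by (metis complex_of_gauss_inverse complex.collapse)
    moreover have "m \<in> {-\<lceil>b\<rceil>..\<lceil>b\<rceil>}" "n \<in> {-\<lceil>b\<rceil>..\<lceil>b\<rceil>}"
      using z mn by (simp; linarith)+
    ultimately show "z \<in> (\<lambda>(m, n). Abs_gauss_int (Complex (of_int m) (of_int n))) `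
          ({-\<lceil>b\<rceil>..\<lceil>b\<rceil>} \<times> {-\<lceil>b\<rceil>..\<lceil>b\<rceil>})"
      by (intro image_eqI[of _ _ "(m, n)"]) simp_all
  qed
  then show ?thesis
    by (rule finite_subset) simp
qed

lemma infinite_UNIV_gauss_int: "infinite (UNIV :: gauss_int set)"
proof
  assume "finite (UNIV :: gauss_int set)"
  moreover have "inj (\<lambda>n :: int. Abs_gauss_int (of_int n))"
    by (rule injI) (simp add: Abs_gauss_int_inject)
  ultimately have "finite (UNIV :: int set)"
    by (meson finite_imageD finite_subset subset_UNIV)
  then show False
    by simp
qed

text \<open>Division with remainder: rounding both coordinates of the complex quotient leaves a
  remainder of modulus at most that of \<open>a\<close>. All such remainders lie in a box with
  finitely many Gaussian integers.\<close>

lemma gauss_int_principal_ideal_finite_index: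
  fixes a :: gauss_int
  assumes "a \<noteq> 0"
  obtains R where "finite R" "\<And>y. \<exists>r\<in>R. \<exists>q. y = r + a * q"
proof
  let ?c = complex_of_gauss
  let ?R = "{z. \<bar>Re (?c z)\<bar> \<le> cmod (?c a) \<and> \<bar>Im (?c z)\<bar> \<le> cmod (?c a)}"
  show "finite ?R"
    by (rule finite_gauss_int_bounded)
  fix y
  have a: "?c a \<noteq> 0"
    using assms by transfer
  define w where "w = ?c y / ?c a"
  define q where "q = Abs_gauss_int (Complex (of_int (round (Re w))) (of_int (round (Im w))))"
  have q: "?c q = Complex (of_int (round (Re w))) (of_int (round (Im w)))"
    unfolding q_def by (simp add: Abs_gauss_int_inverse)
  have "\<bar>Re (w - ?c q)\<bar> \<le> 1/2" "\<bar>Im (w - ?c q)\<bar> \<le> 1/2"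
    using of_int_round_abs_le[of "Re w"] of_int_round_abs_le[of "Im w"]
    by (simp_all add: q abs_minus_commute)
  \<comment> \<open>The modulus is at most the sum of the absolute values of the two coordinates,
    here 1/2 + 1/2.\<close>
  then have "cmod (w - ?c q) \<le> 1"
    using cmod_le[of "w - ?c q"] by linarith
  moreover have "?c (y - a * q) = ?c a * (w - ?c q)"
    using a by (simp add: minus_gauss_int.rep_eq times_gauss_int.rep_eq w_def algebra_simps)
  ultimately have "cmod (?c (y - a * q)) \<le> cmod (?c a)"
    by (simp add: norm_mult mult_left_le)
  then have "y - a * q \<in> ?R"
    using abs_Re_le_cmod[of "?c (y - a * q)"] abs_Im_le_cmod[of "?c (y - a * q)"] by simp
  moreover have "y = (y - a * q) + a * q"
    by simp
  ultimately show "\<exists>r\<in>?R. \<exists>q. y = r + a * q"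
    by blast
qed

section \<open>Rows of the matrix and the final intersection\<close>

lemma PS_star_vimage_row:
  fixes A :: "gauss_int ^ 'v ^ 'u"
  assumes "A $ i $ j \<noteq> 0" "PS_star C"
  shows "PS_star ((\<lambda>z. (A *v z) $ i) -` C)"
proof -
  obtain R where R: "finite R" "\<And>y. \<exists>r\<in>R. \<exists>q. y = r + A $ i $ j * q"
    using gauss_int_principal_ideal_finite_index[OF assms(1)] by blast
  \<comment> \<open>Vectors supported at \<open>j\<close> show that the image of the row contains
    the ideal generated by \<open>A $ i $ j\<close>, so \<open>R\<close> serves for the row
    too.\<close>
  have "(A *v axis j q) $ i = A $ i $ j * q" for q
    by (simp add: matrix_vector_mult_def axis_def if_distrib cong: if_cong)
  then have "\<exists>r\<in>R. \<exists>z. y = r + (A *v z) $ i" for y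
    using R(2)[of y] by metis
  then show ?thesis
    using R(1) assms(2)
    by (intro PS_star_vimage[where R = R])
      (auto simp: matrix_vector_mult_def distrib_left sum.distrib)
qed

theorem theorem2p9:
  fixes A :: "gauss_int ^ 'v ^ 'u" and C :: "gauss_int set"
  assumes "\<forall>z \<in> vecs_over (UNIV - {0}). A *v z \<in> vecs_over (UNIV - {0})"
    and "PS_star C"
  shows "PS_star {z \<in> vecs_over (UNIV - {0}). A *v z \<in> vecs_over C}"
proof -
  have row: "\<exists>j. A $ i $ j \<noteq> 0" for i
  proof (rule ccontr)
    assume "\<nexists>j. A $ i $ j \<noteq> 0"
    \<comment> \<open>The all-ones vector has no zero entry, so a zero row would contradict the
      hypothesis on \<open>A\<close>.\<close>
    then have "(A *v (\<chi> j. 1)) $ i = 0"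
      by (simp add: matrix_vector_mult_def)
    moreover have "(\<chi> j. 1) \<in> (vecs_over (UNIV - {0}) :: (gauss_int ^ 'v) set)"
      by (simp add: vecs_over_def)
    ultimately show False
      using assms(1) by (auto simp: vecs_over_def)
  qed
  have rows: "PS_star (\<Inter>i. (\<lambda>z. (A *v z) $ i) -` C)"
    using row assms(2) by (intro PS_star_INT) (auto intro: PS_star_vimage_row)
  have "PS_star ((\<lambda>z :: gauss_int ^ 'v. z $ j) -` (UNIV - {0}))" for j
  \<comment> \<open>A coordinate projection is onto, as constant vectors show, so 0 is the only
    representative.\<close>
  proof (rule PS_star_vimage[where R = "{0}"])
    show "\<exists>r\<in>{0}. \<exists>z :: gauss_int ^ 'v. y = r + z $ j" for y
      by (auto intro: exI[of _ "\<chi> k. y"])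
  qed (simp_all add: PS_star_minus_singleton[OF infinite_UNIV_gauss_int])
  then have coords: "PS_star (\<Inter>j. (\<lambda>z :: gauss_int ^ 'v. z $ j) -` (UNIV - {0}))"
    by (intro PS_star_INT) auto
  have "{z \<in> vecs_over (UNIV - {0}). A *v z \<in> vecs_over C} =
      (\<Inter>j. (\<lambda>z :: gauss_int ^ 'v. z $ j) -` (UNIV - {0})) \<inter> (\<Inter>i. (\<lambda>z. (A *v z) $ i) -` C)"
    by (auto simp: vecs_over_def)
  then show ?thesis
    using PS_star_Int[OF coords rows] by simp
qed

end
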